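(* Let $A\in\mathbb{R}^{n\times n}$, $B\in\mathbb{R}^{n\times m}$, $D\in\mathbb{R}^{n\times r}$ be such that $(A,B)$ and $(A,D)$ are controllable, and let $P_d\in\mathbb{S}_{++}^n$. Consider the two optimization problems: (I) over $P$: $$\min_{P}\ d_{\mathrm{BW}}^2(P,P_d)\quad\text{s.t.}\quad P\in\mathbb{S}_{++}^n,\quad (I_n-BB^\dagger)\left(AP+PA^\top+DD^\top\right)(I_n-BB^\dagger)=O_n ;$$ (II) over $P$, $E\in\mathbb{R}^{m\times n}$ and $U\in\mathbb{R}^{n\times n}$: $$\min_{P,E,U}\ \mathrm{tr}(P+P_d-2U)\quad\text{s.t.}\quad P\in\mathbb{S}_{++}^n,\quad \begin{bmatrix} P & U \\ U^\top & P_d \end{bmatrix}\succeq 0,\quad AP+BE+PA^\top+E^\top B^\top+DD^\top=O_n .$$ Then the solution to the optimization problem (I) can be obtained by solving the problem (II).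
   Context: $\mathbb{S}_{+}^n$ and $\mathbb{S}_{++}^n$ denote the sets of real symmetric $n\times n$ positive semidefinite and positive definite matrices, respectively; $M\succeq 0$ means $M$ is symmetric positive semidefinite. $B^\dagger$ is the Moore--Penrose pseudoinverse of $B$, $I_n$ the identity matrix and $O_n$ the $n\times n$ zero matrix. For $X,Y\in\mathbb{S}_+^n$, the Bures--Wasserstein distance is $$d_{\mathrm{BW}}(X,Y)=\left(\mathrm{tr}\left(X+Y-2\left(Y^{1/2}XY^{1/2}\right)^{1/2}\right)\right)^{1/2},$$ where $M^{1/2}$ denotes the unique positive semidefinite square root of $M\in\mathbb{S}_+^n$. The matrices come from the linear system $\dot{x}=Ax+Bu+Dv$ with state $x\in\mathbb{R}^n$, internal control input $u\in\mathbb{R}^m$ and exogenous input $v\in\mathbb{R}^r$; $P_d$ is a desired controllability Gramian from $v$ to $x$. *)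

theory Defs
  imports "HOL-Analysis.Analysis"
begin

definition pos_semidef :: "real^'n^'n \<Rightarrow> bool" where
  "pos_semidef M \<longleftrightarrow> transpose M = M \<and> (\<forall>x. 0 \<le> x \<bullet> (M *v x))"

definition pos_def :: "real^'n^'n \<Rightarrow> bool" where
  "pos_def M \<longleftrightarrow> transpose M = M \<and> (\<forall>x. x \<noteq> 0 \<longrightarrow> 0 < x \<bullet> (M *v x))"

text \<open>The description determines the value only for positive semidefinite arguments.\<close>
definition psd_sqrt :: "real^'n^'n \<Rightarrow> real^'n^'n" where
  "psd_sqrt M = (THE S. pos_semidef S \<and> S ** S = M)"

text \<open>The four Penrose equations characterise the Moore--Penrose pseudoinverse uniquely.\<close>
definition pinv :: "real^'m^'n \<Rightarrow> real^'n^'m" where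
  "pinv B = (THE X. B ** X ** B = B \<and> X ** B ** X = X \<and>
                    transpose (B ** X) = B ** X \<and> transpose (X ** B) = X ** B)"

definition bw_dist :: "real^'n^'n \<Rightarrow> real^'n^'n \<Rightarrow> real" where
  "bw_dist X Y =
     sqrt (trace (X + Y - 2 *\<^sub>R psd_sqrt (psd_sqrt Y ** X ** psd_sqrt Y)))"

text \<open>The block matrix with rows \<open>P U\<close> and \<open>V W\<close>; the left summand of an index type
  \<open>'a + 'b\<close> indexes the first block.\<close>
definition block_matrix ::
  "'a^'m^'n \<Rightarrow> 'a^'k^'n \<Rightarrow> 'a^'m^'l \<Rightarrow> 'a^'k^'l \<Rightarrow> 'a^('m + 'k)^('n + 'l)" where
  "block_matrix P U V W = (\<chi> i j.
     case i of
       Inl a \<Rightarrow> (case j of Inl b \<Rightarrow> P $ a $ b | Inr b \<Rightarrow> U $ a $ b)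
     | Inr a \<Rightarrow> (case j of Inl b \<Rightarrow> V $ a $ b | Inr b \<Rightarrow> W $ a $ b))"

text \<open>Controllability of \<open>x' = A x + B u\<close>: any state can be steered to any other state in
  finite time by a continuous input.\<close>
definition controllable :: "real^'n^'n \<Rightarrow> real^'k^'n \<Rightarrow> bool" where
  "controllable A B \<longleftrightarrow>
     (\<forall>x0 x1. \<exists>T>0. \<exists>(u :: real \<Rightarrow> real^'k) (x :: real \<Rightarrow> real^'n).
        continuous_on {0..T} u \<and> x 0 = x0 \<and> x T = x1 \<and>
        (\<forall>t\<in>{0..T}. (x has_vector_derivative (A *v x t + B *v u t)) (at t within {0..T})))"

definition feasible_I ::
  "real^'n^'n \<Rightarrow> real^'m^'n \<Rightarrow> real^'r^'n \<Rightarrow> real^'n^'n \<Rightarrow> bool" where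
  "feasible_I A B D P \<longleftrightarrow>
     pos_def P \<and>
     (mat 1 - B ** pinv B) ** (A ** P + P ** transpose A + D ** transpose D)
       ** (mat 1 - B ** pinv B) = 0"

definition objective_I :: "real^'n^'n \<Rightarrow> real^'n^'n \<Rightarrow> real" where
  "objective_I Pd P = (bw_dist P Pd)\<^sup>2"

definition feasible_II ::
  "real^'n^'n \<Rightarrow> real^'m^'n \<Rightarrow> real^'r^'n \<Rightarrow> real^'n^'n
    \<Rightarrow> (real^'n^'n) \<times> (real^'n^'m) \<times> (real^'n^'n) \<Rightarrow> bool" where
  "feasible_II A B D Pd = (\<lambda>(P, E, U).
     pos_def P \<and>
     pos_semidef (block_matrix P U (transpose U) Pd) \<and>
     A ** P + B ** E + P ** transpose A + transpose E ** transpose B + D ** transpose D = 0)"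

definition objective_II ::
  "real^'n^'n \<Rightarrow> (real^'n^'n) \<times> (real^'n^'m) \<times> (real^'n^'n) \<Rightarrow> real" where
  "objective_II Pd = (\<lambda>(P, E, U). trace (P + Pd - 2 *\<^sub>R U))"

end

theory Submission
  imports Defs
begin

text \<open>Problem (I) is problem (II) with the variables \<open>E\<close> and \<open>U\<close> eliminated.  For fixed \<open>P\<close>
  they occur in separate constraints, so they can be eliminated independently.

  The variable \<open>E\<close> occurs only in the linear equation, and \<open>B B\<^sup>\<dagger>\<close> is the orthogonal projection
  onto the range of \<open>B\<close>.  For symmetric \<open>Q\<close> the equation \<open>B E + (B E)\<^sup>T + Q = 0\<close> is solvable exactly
  when \<open>Q\<close> vanishes after compression to the orthogonal complement of that range
  (\<open>projected_equation_iff_solvable\<close>).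

  The variable \<open>U\<close> occurs only in the block constraint and the objective.  The largest trace of
  a \<open>U\<close> that keeps the block matrix positive semidefinite is the trace of
  \<open>(Pd\<^sup>1\<^sup>/\<^sup>2 P Pd\<^sup>1\<^sup>/\<^sup>2)\<^sup>1\<^sup>/\<^sup>2\<close>, and it is attained (\<open>fidelity_is_max_trace\<close>): the upper bound comes from
  testing the block form on suitable vectors, the attainment from a \<open>U\<close> for which the block form
  is a perfect square.  So the squared distance is the attained minimum of the
  objective of (II) over \<open>U\<close> (\<open>objective_I_is_min\<close>).

  Minimizers therefore correspond under the projection \<open>(P, E, U) \<mapsto> P\<close>
  (\<open>is_arg_min_partial_minimization\<close>).  Square root and pseudoinverse are given by definite
  descriptions, so both have to be shown to exist uniquely; for the square root, existence is a
  fixed-point argument and uniqueness a trace argument.\<close>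

section \<open>Symmetric matrices, traces and quadratic forms\<close>

lemma inner_matrix_vector_left:
  fixes M :: "real^'m^'n"
  shows "(M *v x) \<bullet> y = x \<bullet> (transpose M *v y)"
  by (metis dot_lmul_matrix vector_transpose_matrix transpose_transpose)

lemma symmetric_matrix_iff:
  fixes M :: "real^'n^'n"
  shows "transpose M = M \<longleftrightarrow> (\<forall>x y. (M *v x) \<bullet> y = x \<bullet> (M *v y))"
proof
  assume "transpose M = M"
  then show "\<forall>x y. (M *v x) \<bullet> y = x \<bullet> (M *v y)"
    by (metis inner_matrix_vector_left)
next
  assume "\<forall>x y. (M *v x) \<bullet> y = x \<bullet> (M *v y)"
  then have "x \<bullet> (transpose M *v y) = x \<bullet> (M *v y)" for x y
    by (metis inner_matrix_vector_left)
  then have "transpose M *v y = M *v y" for y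
    by (metis vector_eq_ldot)
  then show "transpose M = M"
    unfolding matrix_eq by blast
qed

lemma matrix_diff_ldistrib:
  fixes A :: "real^'m^'n"
  shows "A ** (B - C) = A ** B - A ** C"
  by (simp add: matrix_matrix_mult_def vec_eq_iff sum_subtractf algebra_simps)

lemma matrix_diff_rdistrib:
  fixes A :: "real^'m^'n"
  shows "(A - B) ** C = A ** C - B ** C"
  by (simp add: matrix_matrix_mult_def vec_eq_iff sum_subtractf algebra_simps)

lemma matrix_add_rdistrib:
  fixes A :: "real^'m^'n"
  shows "(A + B) ** C = A ** C + B ** C"
  by (simp add: matrix_matrix_mult_def vec_eq_iff sum.distrib algebra_simps)

lemma matrix_minus_right:
  fixes A :: "real^'m^'n"
  shows "A ** (- B) = - (A ** B)"
  by (simp add: matrix_matrix_mult_def vec_eq_iff sum_negf)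

lemma matrix_minus_left:
  fixes A :: "real^'m^'n"
  shows "(- A) ** B = - (A ** B)"
  by (simp add: matrix_matrix_mult_def vec_eq_iff sum_negf)

lemma matrix_scaleR_right:
  fixes A :: "real^'m^'n"
  shows "A ** (c *\<^sub>R B) = c *\<^sub>R (A ** B)"
  by (simp add: matrix_scalar_ac scalar_matrix_assoc)

lemma transpose_add: "transpose (A + B) = transpose A + transpose (B :: real^'m^'n)"
  by (simp add: transpose_def vec_eq_iff)

lemma transpose_diff: "transpose (A - B) = transpose A - transpose (B :: real^'m^'n)"
  by (simp add: transpose_def vec_eq_iff)

lemma trace_scaleR: "trace (c *\<^sub>R A) = c * trace (A :: real^'n^'n)"
  by (simp add: trace_def sum_distrib_left)

lemma trace_eq_sum_quadratic_form:
  fixes M :: "real^'n^'n"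
  shows "trace M = (\<Sum>i\<in>UNIV. axis i 1 \<bullet> (M *v axis i 1))"
  by (simp add: trace_def matrix_vector_mul_component inner_axis'
      matrix_vector_mult_basis column_def)

lemma transpose_mult_self_eq_0:
  fixes M :: "real^'m^'n"
  assumes "transpose M ** M = 0"
  shows "M = 0"
proof -
  have "M *v x = 0" for x
  proof -
    have "(M *v x) \<bullet> (M *v x) = x \<bullet> ((transpose M ** M) *v x)"
      by (simp only: inner_matrix_vector_left matrix_vector_mul_assoc)
    then show ?thesis by (simp add: assms)
  qed
  then show ?thesis by (simp add: matrix_eq)
qed

section \<open>Square roots of positive definite matrices\<close>

text \<open>For small \<open>t > 0\<close> the step from \<open>x\<close> in the direction \<open>- S x\<close> changes the form by
  \<open>- 2 t |S x|\<^sup>2\<close> to first order, which would make it negative if \<open>S x\<close> were nonzero.\<close>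
lemma pos_semidef_kernel:
  fixes S :: "real^'n^'n"
  assumes S: "pos_semidef S" and 0: "x \<bullet> (S *v x) = 0"
  shows "S *v x = 0"
proof -
  define y where "y = S *v x"
  define c where "c = y \<bullet> (S *v y)"
  have sym: "(S *v u) \<bullet> v = u \<bullet> (S *v v)" for u v
    using S by (simp add: pos_semidef_def symmetric_matrix_iff)
  have key: "2 * (y \<bullet> y) \<le> t * c" if "t > 0" for t
  proof -
    have "0 \<le> (x - t *\<^sub>R y) \<bullet> (S *v (x - t *\<^sub>R y))"
      using S by (simp add: pos_semidef_def)
    also have "\<dots> = x \<bullet> (S *v x) - t * (y \<bullet> (S *v x)) - t * (x \<bullet> (S *v y)) + t * t * c"
      by (simp add: matrix_vector_mult_diff_distrib matrix_vector_mult_scaleR inner_diff_left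
          inner_diff_right c_def algebra_simps)
    also have "x \<bullet> (S *v y) = y \<bullet> y"
      by (simp add: y_def flip: sym)
    also have "y \<bullet> (S *v x) = y \<bullet> y" by (simp add: y_def)
    finally have "t * (2 * (y \<bullet> y)) \<le> t * (t * c)"
      using 0 by (simp add: algebra_simps)
    then show ?thesis using that by simp
  qed
  have "c \<ge> 0" using S by (simp add: pos_semidef_def c_def)
  have "y \<bullet> y \<le> 0"
  proof (rule field_le_epsilon)
    fix e :: real assume "e > 0"
    have "2 * (y \<bullet> y) \<le> e / (c + 1) * c"
      using \<open>e > 0\<close> \<open>c \<ge> 0\<close> by (intro key) simp
    also have "\<dots> \<le> e" using \<open>e > 0\<close> \<open>c \<ge> 0\<close> by (simp add: field_simps)
    finally show "y \<bullet> y \<le> 0 + e"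
      using \<open>e > 0\<close> by simp
  qed
  then have "y = 0" using inner_gt_zero_iff[of y] by linarith
  then show ?thesis by (simp add: y_def)
qed

text \<open>With \<open>D = S - T\<close>, equality of the squares gives \<open>S D + D T = 0\<close>, without any
  commutation of \<open>S\<close> and \<open>T\<close>.  Multiplying by \<open>D\<close> and taking traces makes the nonnegative
  traces of \<open>D S D\<close> and \<open>D T D\<close> add up to zero.  Hence \<open>S\<close> and \<open>T\<close> both vanish on the range
  of \<open>D\<close>, so \<open>D\<^sup>2 = 0\<close>, and a symmetric matrix with zero square is zero.\<close>
lemma psd_square_root_unique:
  fixes S T :: "real^'n^'n"
  assumes S: "pos_semidef S" and T: "pos_semidef T" and eq: "S ** S = T ** T"
  shows "S = T"
proof -
  define D where "D = S - T"
  have D: "transpose D = D"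
    using S T by (simp add: D_def pos_semidef_def transpose_diff)
  have "S ** D + D ** T = 0"
    by (simp add: D_def matrix_diff_ldistrib matrix_diff_rdistrib eq)
  then have "trace (S ** D ** D) + trace (D ** T ** D) = 0"
    by (metis matrix_add_rdistrib trace_add times0_left trace_0 mat_0)
  moreover have "trace (S ** D ** D) = trace (D ** S ** D)"
    using trace_mul_sym[of D "S ** D"] by (simp add: matrix_mul_assoc)
  moreover have tr: "trace (D ** M ** D) = (\<Sum>i\<in>UNIV. (D *v axis i 1) \<bullet> (M *v (D *v axis i 1)))"
    for M :: "real^'n^'n"
    unfolding trace_eq_sum_quadratic_form inner_matrix_vector_left D
    by (simp only: matrix_vector_mul_assoc matrix_mul_assoc)
  moreover have "M *v (D *v axis i 1) = 0"
    if M: "pos_semidef M" and t0: "trace (D ** M ** D) = 0" for M :: "real^'n^'n" and i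
  proof -
    have "(D *v axis i 1) \<bullet> (M *v (D *v axis i 1)) = 0"
      using M t0 unfolding tr pos_semidef_def by (simp add: sum_nonneg_eq_0_iff)
    then show ?thesis by (rule pos_semidef_kernel[OF M])
  qed
  moreover have "trace (D ** M ** D) \<ge> 0" if "pos_semidef M" for M :: "real^'n^'n"
    unfolding tr using that by (auto simp: pos_semidef_def intro: sum_nonneg)
  ultimately have "S *v (D *v axis i 1) = 0" "T *v (D *v axis i 1) = 0" for i
    using S T by (smt (verit))+
  then have DD: "D *v (D *v axis i 1) = 0" for i
    by (simp add: D_def matrix_vector_mult_diff_rdistrib)
  have "D *v axis i 1 = 0" for i
  proof -
    have "(D *v axis i 1) \<bullet> (D *v axis i 1) = axis i 1 \<bullet> (D *v (D *v axis i 1))"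
      by (simp only: inner_matrix_vector_left D)
    then show ?thesis by (simp only: DD) simp
  qed
  then have "D = 0"
    by (simp add: matrix_vector_mult_basis column_def vec_eq_iff)
  then show ?thesis by (simp add: D_def)
qed

text \<open>Rewriting \<open>(1 - Y)\<^sup>2 = 1 - A\<close> as \<open>Y = (A + Y\<^sup>2) / 2\<close> turns the square root of \<open>1 - A\<close> into a
  fixed point.  On the self-adjoint operators of norm at most \<open>\<parallel>A\<parallel>\<close> the right-hand side is a
  contraction with constant \<open>\<parallel>A\<parallel> < 1\<close>, so square roots are obtained without a spectral
  theorem.\<close>
lemma quadratic_operator_equation:
  fixes A :: "'a::euclidean_space \<Rightarrow>\<^sub>L 'a"
  assumes A: "norm A < 1" and sym: "\<And>x y. A x \<bullet> y = x \<bullet> A y"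
  obtains Y :: "'a \<Rightarrow>\<^sub>L 'a"
  where "norm Y \<le> 1" "\<And>x y. Y x \<bullet> y = x \<bullet> Y y" "2 *\<^sub>R Y = A + (Y o\<^sub>L Y)"
proof -
  define a where "a = norm A"
  define K where "K = {Y :: 'a \<Rightarrow>\<^sub>L 'a. norm Y \<le> a \<and>
      (\<forall>x y. blinfun_apply Y x \<bullet> y = x \<bullet> blinfun_apply Y y)}"
  define f where "f Y = (1/2) *\<^sub>R (A + (Y o\<^sub>L Y))" for Y :: "'a \<Rightarrow>\<^sub>L 'a"
  have a: "0 \<le> a" "a < 1" using A by (auto simp: a_def)
  have "closed K"
    unfolding K_def
    by (intro closed_Collect_conj closed_Collect_all closed_Collect_le closed_Collect_eq
        continuous_intros)
  then have "complete K" by (simp add: complete_eq_closed)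
  have "\<exists>!Y\<in>K. f Y = Y"
  proof (rule Banach_fix[OF \<open>complete K\<close> _ a])
    show "K \<noteq> {}"
      using a by (auto simp: K_def intro!: exI[of _ 0])
    show "f ` K \<subseteq> K"
    proof safe
      fix Y assume Y: "Y \<in> K"
      have "norm (Y o\<^sub>L Y) \<le> norm Y * norm Y" by (rule norm_blinfun_compose)
      also have "\<dots> \<le> a * 1"
        using Y a by (intro mult_mono) (auto simp: K_def)
      finally have "norm (f Y) \<le> a"
        unfolding f_def using norm_triangle_ineq[of A "Y o\<^sub>L Y"] by (simp add: a_def)
      moreover have "f Y x \<bullet> y = x \<bullet> f Y y" for x y
        using Y sym by (simp add: f_def K_def blinfun.bilinear_simps inner_add_left inner_add_right)
      ultimately show "f Y \<in> K" by (simp add: K_def)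
    qed
    fix Y Z assume YZ: "Y \<in> K" "Z \<in> K"
    have "f Y - f Z = (1/2) *\<^sub>R ((Y o\<^sub>L (Y - Z)) + ((Y - Z) o\<^sub>L Z))"
      by (rule blinfun_eqI) (simp add: f_def blinfun.bilinear_simps algebra_simps)
    moreover have "norm (Y o\<^sub>L (Y - Z)) \<le> a * norm (Y - Z)"
      using YZ by (intro order_trans[OF norm_blinfun_compose] mult_right_mono) (auto simp: K_def)
    moreover have "norm ((Y - Z) o\<^sub>L Z) \<le> norm (Y - Z) * a"
      using YZ by (intro order_trans[OF norm_blinfun_compose] mult_left_mono) (auto simp: K_def)
    ultimately show "dist (f Y) (f Z) \<le> a * dist Y Z"
      using norm_triangle_ineq[of "Y o\<^sub>L (Y - Z)" "(Y - Z) o\<^sub>L Z"]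
      by (simp add: dist_norm mult.commute)
  qed
  then obtain Y where Y: "Y \<in> K" "f Y = Y" by auto
  show thesis
  proof
    show "norm Y \<le> 1" "\<And>x y. Y x \<bullet> y = x \<bullet> Y y" using Y a by (auto simp: K_def)
    have "2 *\<^sub>R Y = 2 *\<^sub>R f Y" using Y by simp
    then show "2 *\<^sub>R Y = A + (Y o\<^sub>L Y)" by (simp add: f_def)
  qed
qed

lemma pos_def_coercive:
  fixes M :: "real^'n^'n"
  assumes "pos_def M"
  obtains m where "m > 0" "\<And>x. m * (norm x)\<^sup>2 \<le> x \<bullet> (M *v x)"
proof -
  have "continuous_on (sphere 0 1) (\<lambda>x. x \<bullet> (M *v x))"
    by (intro continuous_intros linear_continuous_on) auto
  moreover have "sphere 0 1 \<noteq> ({} :: (real^'n) set)" by simp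
  ultimately obtain u :: "real^'n" where u: "norm u = 1"
    and min: "\<And>x. norm x = 1 \<Longrightarrow> u \<bullet> (M *v u) \<le> x \<bullet> (M *v x)"
    using continuous_attains_inf[OF compact_sphere, of 0 1 "\<lambda>x. x \<bullet> (M *v x)"] by auto
  show thesis
  proof
    show "u \<bullet> (M *v u) > 0" using assms u norm_zero zero_neq_one unfolding pos_def_def by metis
    fix x :: "real^'n"
    show "u \<bullet> (M *v u) * (norm x)\<^sup>2 \<le> x \<bullet> (M *v x)"
    proof (cases "x = 0")
      case False
      then have "u \<bullet> (M *v u) \<le> (x /\<^sub>R norm x) \<bullet> (M *v (x /\<^sub>R norm x))"
        by (intro min) simp
      with False show ?thesis
        by (simp add: matrix_vector_mult_scaleR field_simps power2_eq_square)
    qed simp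
  qed
qed

text \<open>Write \<open>M = c (1 - A)\<close>.  If \<open>m\<close> is a coercivity constant of \<open>M\<close> and \<open>L\<close> a Lipschitz constant,
  then \<open>\<parallel>A x\<parallel>\<^sup>2 \<le> (1 - 2 m / c + L\<^sup>2 / c\<^sup>2) \<parallel>x\<parallel>\<^sup>2\<close>, and the factor is least for
  \<open>c = L\<^sup>2 / m\<close>, where it equals \<open>1 - m\<^sup>2 / L\<^sup>2 < 1\<close>.  So \<open>A\<close> is a contraction, \<open>1 - A\<close> has the
  root \<open>1 - Y\<close>, and \<open>\<parallel>Y\<parallel> \<le> 1\<close> makes that root positive semidefinite.\<close>
lemma psd_square_root_exists:
  fixes M :: "real^'n^'n"
  assumes M: "pos_def M"
  obtains S where "pos_semidef S" "S ** S = M"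
proof -
  obtain m where m: "m > 0" "\<And>x. m * (norm x)\<^sup>2 \<le> x \<bullet> (M *v x)"
    using pos_def_coercive[OF M] by blast
  \<comment> \<open>The summand \<open>m\<close> makes \<open>m \<le> L\<close> immediate, so that the square root below has a nonnegative argument.\<close>
  define L where "L = onorm (\<lambda>x. M *v x) + m"
  have Lip: "norm (M *v x) \<le> L * norm x" for x
  proof -
    have "norm (M *v x) \<le> onorm (\<lambda>x. M *v x) * norm x" by (rule onorm) simp
    also have "\<dots> \<le> L * norm x" using m by (intro mult_right_mono) (auto simp: L_def)
    finally show ?thesis .
  qed
  have L: "L \<ge> m" using onorm_pos_le[of "\<lambda>x. M *v x"] by (simp add: L_def)
  define c where "c = L\<^sup>2 / m"
  have c: "c > 0" using L m by (simp add: c_def)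
  have symM: "(M *v u) \<bullet> v = u \<bullet> (M *v v)" for u v
    using M by (simp add: pos_def_def symmetric_matrix_iff)
  have bl: "bounded_linear (\<lambda>x. (mat 1 - (1/c) *\<^sub>R M) *v x)" by simp
  define A where "A = Blinfun (\<lambda>x. (mat 1 - (1/c) *\<^sub>R M) *v x)"
  have A: "A x = x - (1/c) *\<^sub>R (M *v x)" for x
    using bl by (simp add: A_def bounded_linear_Blinfun_apply matrix_vector_mult_diff_rdistrib
        scaleR_matrix_vector_assoc)
  have "norm A \<le> sqrt (1 - m\<^sup>2 / L\<^sup>2)"
  proof (rule norm_blinfun_bound)
    have "m\<^sup>2 \<le> L\<^sup>2" using L m by simp
    then show q: "0 \<le> sqrt (1 - m\<^sup>2 / L\<^sup>2)" using m L by simp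
    fix x
    have "(norm (A x))\<^sup>2 = (norm x)\<^sup>2 - (2/c) * (x \<bullet> (M *v x)) + (1/c)\<^sup>2 * (norm (M *v x))\<^sup>2"
      unfolding A power2_norm_eq_inner
      by (simp add: inner_diff_left inner_diff_right inner_commute algebra_simps power2_eq_square)
    also have "\<dots> \<le> (norm x)\<^sup>2 - (2/c) * (m * (norm x)\<^sup>2) + (1/c)\<^sup>2 * (L * norm x)\<^sup>2"
      using c m Lip by (intro add_mono diff_mono mult_left_mono power_mono) auto
    also have "\<dots> = (1 - m\<^sup>2 / L\<^sup>2) * (norm x)\<^sup>2"
      using m L by (simp add: c_def field_simps power2_eq_square)
    finally have "sqrt ((norm (A x))\<^sup>2) \<le> sqrt ((1 - m\<^sup>2 / L\<^sup>2) * (norm x)\<^sup>2)"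
      by (rule real_sqrt_le_mono)
    then show "norm (A x) \<le> sqrt (1 - m\<^sup>2 / L\<^sup>2) * norm x"
      by (simp add: real_sqrt_mult)
  qed
  also have "\<dots> < 1" using m L by simp
  finally have "norm A < 1" .
  moreover have "A x \<bullet> y = x \<bullet> A y" for x y
    by (simp add: A inner_diff_left inner_diff_right symM)
  ultimately obtain Y :: "(real^'n) \<Rightarrow>\<^sub>L (real^'n)"
    where Y: "norm Y \<le> 1" "\<And>x y. Y x \<bullet> y = x \<bullet> Y y" "2 *\<^sub>R Y = A + (Y o\<^sub>L Y)"
    using quadratic_operator_equation by blast
  define S where "S = matrix (\<lambda>x. sqrt c *\<^sub>R (x - Y x))"
  have S: "S *v x = sqrt c *\<^sub>R (x - Y x)" for x
  proof -
    have "linear (\<lambda>x. sqrt c *\<^sub>R (x - Y x))"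
      by (rule linearI) (simp_all add: blinfun.bilinear_simps algebra_simps)
    then show ?thesis by (simp add: S_def matrix_works)
  qed
  show thesis
  proof
    have "0 \<le> x \<bullet> (S *v x)" for x
    proof -
      have "x \<bullet> Y x \<le> norm x * (norm Y * norm x)"
        by (intro order_trans[OF norm_cauchy_schwarz] mult_left_mono norm_blinfun) simp
      also have "\<dots> \<le> norm x * (1 * norm x)"
        using Y by (intro mult_left_mono mult_right_mono) auto
      finally show ?thesis
        using c by (simp add: S inner_diff_right power2_norm_eq_inner[symmetric] power2_eq_square
            zero_le_mult_iff)
    qed
    then show "pos_semidef S"
      by (auto simp: pos_semidef_def symmetric_matrix_iff S inner_diff_left inner_diff_right Y(2))
    have "S *v (S *v x) = M *v x" for x
    proof -
      have 2: "2 *\<^sub>R Y x = A x + Y (Y x)"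
        using arg_cong[OF Y(3), of "\<lambda>F. blinfun_apply F x"] by (simp add: blinfun.bilinear_simps)
      have "S *v (S *v x) = (sqrt c * sqrt c) *\<^sub>R (x - 2 *\<^sub>R Y x + Y (Y x))"
        by (simp add: S blinfun.bilinear_simps scaleR_2 algebra_simps)
      also have "\<dots> = M *v x"
        unfolding 2 A using c by (simp add: algebra_simps)
      finally show ?thesis .
    qed
    then show "S ** S = M" by (simp add: matrix_eq flip: matrix_vector_mul_assoc)
  qed
qed


lemma psd_sqrt_pos_def:
  fixes M :: "real^'n^'n"
  assumes M: "pos_def M"
  shows "pos_def (psd_sqrt M)" and "psd_sqrt M ** psd_sqrt M = M"
proof -
  obtain S where S: "pos_semidef S" "S ** S = M"
    using psd_square_root_exists[OF M] .
  have "psd_sqrt M = S"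
    unfolding psd_sqrt_def using S psd_square_root_unique by (intro the_equality) auto
  moreover have "x \<bullet> (S *v x) > 0" if "x \<noteq> 0" for x
  proof (rule ccontr)
    assume "\<not> x \<bullet> (S *v x) > 0"
    then have "S *v x = 0"
      using S(1) by (intro pos_semidef_kernel) (auto simp: pos_semidef_def intro: antisym)
    then have "M *v x = 0"
      by (simp flip: S(2) matrix_vector_mul_assoc)
    then show False using M that by (auto simp: pos_def_def)
  qed
  ultimately show "pos_def (psd_sqrt M)" "psd_sqrt M ** psd_sqrt M = M"
    using S by (auto simp: pos_def_def pos_semidef_def)
qed

lemma pos_def_inverse:
  fixes S :: "real^'n^'n"
  assumes "pos_def S"
  obtains T where "S ** T = mat 1" "T ** S = mat 1" "transpose T = T"
proof -
  have "\<forall>x. S *v x = 0 \<longrightarrow> x = 0"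
    using assms by (auto simp: pos_def_def)
  then obtain T where TS: "T ** S = mat 1"
    by (metis matrix_left_invertible_ker)
  then have ST: "S ** T = mat 1"
    by (simp add: matrix_left_right_inverse)
  have sym: "transpose S = S" using assms by (simp add: pos_def_def)
  have "transpose T ** S = mat 1"
    using arg_cong[OF ST, of transpose] by (simp add: matrix_transpose_mul sym)
  then have "transpose T = T"
    by (metis ST matrix_mul_assoc matrix_mul_lid matrix_mul_rid)
  with TS ST that show thesis by blast
qed

lemma pos_def_congruence:
  fixes P S :: "real^'n^'n"
  assumes P: "pos_def P" and S: "pos_def S"
  shows "pos_def (S ** P ** S)"
proof -
  have symS: "transpose S = S" using S by (simp add: pos_def_def)
  have "x \<bullet> ((S ** P ** S) *v x) = (S *v x) \<bullet> (P *v (S *v x))" for x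
    unfolding inner_matrix_vector_left symS by (simp only: matrix_vector_mul_assoc matrix_mul_assoc)
  moreover have "S *v x \<noteq> 0" if "x \<noteq> 0" for x
    using S that by (auto simp: pos_def_def)
  ultimately show ?thesis
    using P symS by (auto simp: pos_def_def matrix_transpose_mul matrix_mul_assoc)
qed

section \<open>The pseudoinverse and the projected equation\<close>

lemma matrix_generalized_inverse_exists:
  fixes N :: "real^'m^'n"
  obtains G where "N ** G ** N = N"
proof -
  obtain g where g: "linear g" "\<And>v. v \<in> range ((*v) N) \<Longrightarrow> N *v g v = v"
    using linear_exists_right_inverse_on[of "(*v) N" UNIV] by auto
  have "N ** matrix g ** N = N"
    unfolding matrix_eq
    using g by (simp add: matrix_works flip: matrix_vector_mul_assoc)
  then show thesis by (rule that)
qed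

text \<open>The witness is \<open>G B\<^sup>T\<close> for a generalized inverse \<open>G\<close> of the Gram matrix \<open>N = B\<^sup>T B\<close>.
  Although \<open>G\<close> is arbitrary, \<open>B G N = B\<close> holds because the difference \<open>Z\<close> satisfies
  \<open>B\<^sup>T Z = 0\<close> and hence \<open>Z\<^sup>T Z = 0\<close>.  Then \<open>B G B\<^sup>T\<close> equals \<open>(B G B\<^sup>T) (B G B\<^sup>T)\<^sup>T\<close>, which is
  symmetric.\<close>
lemma least_squares_inverse_exists:
  fixes B :: "real^'m^'n"
  obtains X where "B ** X ** B = B" "transpose (B ** X) = B ** X"
proof -
  define N where "N = transpose B ** B"
  have N: "transpose N = N" by (simp add: N_def matrix_transpose_mul)
  obtain G where G: "N ** G ** N = N" by (rule matrix_generalized_inverse_exists)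
  then have G': "N ** transpose G ** N = N"
    by (metis N matrix_mul_assoc matrix_transpose_mul)
  have BGN: "B ** H ** N = B" if H: "N ** H ** N = N" for H
  proof -
    define Z where "Z = B ** H ** N - B"
    have "transpose B ** Z = 0"
      using H by (simp add: Z_def N_def matrix_diff_ldistrib matrix_mul_assoc)
    moreover have "Z = B ** (H ** N - mat 1)"
      by (simp add: Z_def matrix_diff_ldistrib matrix_mul_assoc)
    then have "transpose Z = transpose (H ** N - mat 1) ** transpose B"
      by (metis matrix_transpose_mul)
    ultimately have "transpose Z ** Z = 0"
      by (metis matrix_mul_assoc times0_right)
    then have "Z = 0" by (rule transpose_mult_self_eq_0)
    then show ?thesis by (simp add: Z_def)
  qed
  show thesis
  proof
    show "B ** (G ** transpose B) ** B = B"
      using BGN[OF G] by (simp add: N_def matrix_mul_assoc)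
    have "B ** G ** N ** transpose G ** transpose B = B ** transpose G ** transpose B"
      using BGN[OF G] by simp
    moreover have "N ** transpose G ** transpose B = transpose B"
      using arg_cong[OF BGN[OF G], of transpose]
      by (simp add: matrix_transpose_mul matrix_mul_assoc N)
    then have "B ** G ** N ** transpose G ** transpose B = B ** G ** transpose B"
      by (metis matrix_mul_assoc)
    ultimately show "transpose (B ** (G ** transpose B)) = B ** (G ** transpose B)"
      by (simp add: matrix_transpose_mul matrix_mul_assoc)
  qed
qed

lemma penrose_unique:
  fixes B :: "real^'m^'n"
  assumes "B ** X ** B = B" "X ** B ** X = X"
    "transpose (B ** X) = B ** X" "transpose (X ** B) = X ** B"
    "B ** Y ** B = B" "Y ** B ** Y = Y"
    "transpose (B ** Y) = B ** Y" "transpose (Y ** B) = Y ** B"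
  shows "X = Y"
proof -
  have BX: "B ** X = B ** Y"
  proof -
    have "B ** X = (B ** Y) ** (B ** X)" using assms by (simp add: matrix_mul_assoc)
    also have "\<dots> = transpose ((B ** X) ** (B ** Y))"
      using assms by (simp add: matrix_transpose_mul[of "B ** X"])
    also have "(B ** X) ** (B ** Y) = B ** Y" using assms by (simp add: matrix_mul_assoc)
    finally show ?thesis using assms by simp
  qed
  have XB: "X ** B = Y ** B"
  proof -
    have "X ** B = (X ** B) ** (Y ** B)" using assms by (metis matrix_mul_assoc)
    also have "\<dots> = transpose ((Y ** B) ** (X ** B))"
      using assms by (simp add: matrix_transpose_mul[of "Y ** B"])
    also have "(Y ** B) ** (X ** B) = Y ** B" using assms by (metis matrix_mul_assoc)
    finally show ?thesis using assms by simp
  qed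
  show ?thesis by (metis BX XB assms(2,6) matrix_mul_assoc)
qed

text \<open>Existence: from a least-squares inverse \<open>V\<close> of \<open>B\<close> and, by transposing, a minimum-norm inverse
  \<open>H\<close>, the product \<open>H B V\<close> inherits \<open>B X = B V\<close> and \<open>X B = H B\<close>, so that all four Penrose
  equations hold.  What is recorded says that \<open>B B\<^sup>\<dagger>\<close> is the orthogonal projection onto the range
  of \<open>B\<close>.\<close>
lemma pinv_penrose:
  fixes B :: "real^'m^'n"
  shows "B ** pinv B ** B = B" and "transpose (B ** pinv B) = B ** pinv B"
proof -
  obtain V where V: "B ** V ** B = B" "transpose (B ** V) = B ** V"
    by (rule least_squares_inverse_exists)
  obtain W where W: "transpose B ** W ** transpose B = transpose B"
    "transpose (transpose B ** W) = transpose B ** W"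
    by (rule least_squares_inverse_exists)
  define H where "H = transpose W"
  have H: "B ** H ** B = B" "transpose (H ** B) = H ** B"
    using arg_cong[OF W(1), of transpose] W(2)
    by (simp_all add: H_def matrix_transpose_mul matrix_mul_assoc)
  define X where "X = H ** B ** V"
  have BX: "B ** X = B ** V" and XB: "X ** B = H ** B"
    using V(1) H(1) by (simp_all add: X_def matrix_mul_assoc) (metis matrix_mul_assoc)
  have "X ** B ** X = X"
    unfolding XB unfolding X_def using H(1) by (metis matrix_mul_assoc)
  then have X: "B ** X ** B = B \<and> X ** B ** X = X \<and>
      transpose (B ** X) = B ** X \<and> transpose (X ** B) = X ** B"
    using V H by (simp add: BX XB)
  have "pinv B = X"
    unfolding pinv_def using X penrose_unique by (intro the_equality) auto
  then show "B ** pinv B ** B = B" "transpose (B ** pinv B) = B ** pinv B"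
    using X by auto
qed

text \<open>Let \<open>P = B B\<^sup>\<dagger>\<close>.  Since \<open>1 - P\<close> annihilates \<open>B\<close> from the left and \<open>B\<^sup>T\<close> from the right, it
  removes the unknown \<open>E\<close> from the linear equation.  Conversely \<open>E = B\<^sup>\<dagger> (Q P / 2 - Q)\<close>
  solves it: it splits the part \<open>P Q P\<close>, which both \<open>B E\<close> and its transpose could absorb,
  evenly between the two, and the remaining defect is \<open>(1 - P) Q (1 - P)\<close>.\<close>
lemma projected_equation_iff_solvable:
  fixes B :: "real^'m^'n" and Q :: "real^'n^'n"
  assumes Q: "transpose Q = Q"
  shows "(mat 1 - B ** pinv B) ** Q ** (mat 1 - B ** pinv B) = 0 \<longleftrightarrow>
    (\<exists>E. B ** E + transpose E ** transpose B + Q = 0)"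
proof -
  define P where "P = B ** pinv B"
  have P: "transpose P = P" and PB: "P ** B = B"
    using pinv_penrose[of B] by (simp_all add: P_def)
  have BP: "transpose B ** P = transpose B"
    using arg_cong[OF PB, of transpose] by (simp add: matrix_transpose_mul P)
  have "(\<exists>E. B ** E + transpose E ** transpose B + Q = 0)"
    if 0: "(mat 1 - P) ** Q ** (mat 1 - P) = 0"
  proof
    define E where "E = pinv B ** ((1/2) *\<^sub>R (Q ** P) - Q)"
    have BE: "B ** E = (1/2) *\<^sub>R (P ** Q ** P) - P ** Q"
      by (simp add: E_def matrix_mul_assoc matrix_diff_ldistrib matrix_scaleR_right flip: P_def)
    have "transpose E ** transpose B = transpose (B ** E)"
      by (simp add: matrix_transpose_mul)
    also have "\<dots> = (1/2) *\<^sub>R (P ** Q ** P) - Q ** P"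
      by (simp add: BE transpose_diff transpose_scalar matrix_transpose_mul P Q matrix_mul_assoc)
    finally have EB: "transpose E ** transpose B = (1/2) *\<^sub>R (P ** Q ** P) - Q ** P" .
    have "B ** E + transpose E ** transpose B + Q
        = ((1/2) *\<^sub>R (P ** Q ** P) + (1/2) *\<^sub>R (P ** Q ** P)) - P ** Q - Q ** P + Q"
      unfolding BE EB by (simp only: algebra_simps)
    also have "(1/2) *\<^sub>R (P ** Q ** P) + (1/2) *\<^sub>R (P ** Q ** P) = P ** Q ** P"
      by (simp flip: scaleR_add_left)
    also have "P ** Q ** P - P ** Q - Q ** P + Q = (mat 1 - P) ** Q ** (mat 1 - P)"
      by (simp add: matrix_diff_ldistrib matrix_diff_rdistrib)
    finally show "B ** E + transpose E ** transpose B + Q = 0" using 0 by simp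
  qed
  moreover have "(mat 1 - P) ** Q ** (mat 1 - P) = 0"
    if E: "B ** E + transpose E ** transpose B + Q = 0" for E
  proof -
    have Qeq: "Q = - (B ** E) - transpose E ** transpose B"
      using E by (simp add: algebra_simps eq_neg_iff_add_eq_0)
    have "(mat 1 - P) ** B = 0" by (simp add: matrix_diff_rdistrib PB)
    then have 1: "(mat 1 - P) ** (B ** E) = 0"
      by (simp add: matrix_mul_assoc)
    have 2: "(transpose E ** transpose B) ** (mat 1 - P) = 0"
      by (simp add: matrix_diff_ldistrib BP flip: matrix_mul_assoc)
    have "(mat 1 - P) ** Q = - ((mat 1 - P) ** (transpose E ** transpose B))"
      unfolding Qeq by (simp add: matrix_diff_ldistrib[of "mat 1 - P"] matrix_minus_right 1)
    then have "(mat 1 - P) ** Q ** (mat 1 - P)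
        = - ((mat 1 - P) ** (transpose E ** transpose B) ** (mat 1 - P))"
      by (simp only: matrix_minus_left)
    also have "\<dots> = - ((mat 1 - P) ** ((transpose E ** transpose B) ** (mat 1 - P)))"
      by (simp only: matrix_mul_assoc)
    finally show ?thesis by (simp only: 2) simp
  qed
  ultimately show ?thesis unfolding P_def by blast
qed

section \<open>The semidefinite block constraint\<close>

lemma sum_UNIV_Plus:
  fixes f :: "'a::finite + 'b::finite \<Rightarrow> real"
  shows "(\<Sum>i\<in>UNIV. f i) = (\<Sum>i\<in>UNIV. f (Inl i)) + (\<Sum>i\<in>UNIV. f (Inr i))"
  using sum.Plus[of "UNIV :: 'a set" "UNIV :: 'b set" f] by (simp add: comp_def)

lemma block_matrix_quadratic_form:
  fixes P :: "real^'n^'n" and U :: "real^'k^'n" and V :: "real^'n^'k" and W :: "real^'k^'k"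
  shows "z \<bullet> (block_matrix P U V W *v z) =
    (let x = (\<chi> i. z $ Inl i); y = (\<chi> i. z $ Inr i)
     in x \<bullet> (P *v x) + x \<bullet> (U *v y) + y \<bullet> (V *v x) + y \<bullet> (W *v y))"
  unfolding Let_def
  by (simp add: inner_vec_def matrix_vector_mult_def block_matrix_def sum_UNIV_Plus
      distrib_left sum.distrib)

lemma pos_semidef_block_matrix_iff:
  fixes P :: "real^'n^'n" and U :: "real^'k^'n" and W :: "real^'k^'k"
  shows "pos_semidef (block_matrix P U (transpose U) W) \<longleftrightarrow>
    transpose P = P \<and> transpose W = W \<and>
    (\<forall>x y. 0 \<le> x \<bullet> (P *v x) + 2 * (x \<bullet> (U *v y)) + y \<bullet> (W *v y))"
proof -
  let ?M = "block_matrix P U (transpose U) W"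
  let ?q = "\<lambda>x y. x \<bullet> (P *v x) + 2 * (x \<bullet> (U *v y)) + y \<bullet> (W *v y)"
  have "transpose ?M = ?M \<longleftrightarrow> transpose P = P \<and> transpose W = W"
    by (auto simp: block_matrix_def transpose_def vec_eq_iff split: sum.splits)
  moreover have q: "z \<bullet> (?M *v z) = ?q (\<chi> i. z $ Inl i) (\<chi> i. z $ Inr i)" for z
  proof -
    have "y \<bullet> (transpose U *v x) = x \<bullet> (U *v y)" for x y
      by (metis inner_commute inner_matrix_vector_left)
    then show ?thesis unfolding block_matrix_quadratic_form Let_def by simp
  qed
  moreover have "(\<forall>z. 0 \<le> z \<bullet> (?M *v z)) \<longleftrightarrow> (\<forall>x y. 0 \<le> ?q x y)"
  proof safe
    fix x y assume nn: "\<forall>z. 0 \<le> z \<bullet> (?M *v z)"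
    show "0 \<le> ?q x y"
      using nn[rule_format, of "\<chi> i. case i of Inl a \<Rightarrow> x $ a | Inr b \<Rightarrow> y $ b"]
      by (simp add: q vec_lambda_eta)
  qed (simp add: q)
  ultimately show ?thesis by (simp add: pos_semidef_def)
qed

text \<open>Weak duality for the block constraint: this is the sum of the nonnegative block forms at the
  vectors \<open>(K e\<^sub>i, - L e\<^sub>i)\<close>.  The matrices \<open>K\<close> and \<open>L\<close> are free to be optimized.\<close>
lemma block_psd_trace_bound:
  fixes P :: "real^'n^'n" and U :: "real^'k^'n" and W :: "real^'k^'k"
    and K :: "real^'l^'n" and L :: "real^'l^'k"
  assumes "pos_semidef (block_matrix P U (transpose U) W)"
  shows "2 * trace (transpose K ** U ** L)
    \<le> trace (transpose K ** P ** K) + trace (transpose L ** W ** L)"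
proof -
  have tr: "trace (transpose X ** M ** Y) = (\<Sum>i\<in>UNIV. (X *v axis i 1) \<bullet> (M *v (Y *v axis i 1)))"
    for X :: "real^'l^'a" and M :: "real^'b^'a" and Y :: "real^'l^'b"
    unfolding trace_eq_sum_quadratic_form inner_matrix_vector_left
    by (simp only: matrix_vector_mul_assoc matrix_mul_assoc)
  have "0 \<le> x \<bullet> (P *v x) - 2 * (x \<bullet> (U *v y)) + y \<bullet> (W *v y)" for x y
    using assms[unfolded pos_semidef_block_matrix_iff, THEN conjunct2, THEN conjunct2,
        rule_format, of x "- y"]
    by (simp add: linear_neg[OF matrix_vector_mul_linear])
  then have "0 \<le> (\<Sum>i\<in>UNIV. (K *v axis i 1) \<bullet> (P *v (K *v axis i 1))
      - 2 * ((K *v axis i 1) \<bullet> (U *v (L *v axis i 1))) + (L *v axis i 1) \<bullet> (W *v (L *v axis i 1)))"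
    by (intro sum_nonneg) blast
  then show ?thesis
    by (simp add: tr sum.distrib sum_subtractf sum_distrib_left)
qed

text \<open>The trace in the Bures--Wasserstein distance is the optimal value of a semidefinite program in
  \<open>U\<close>.  With \<open>S = Pd\<^sup>1\<^sup>/\<^sup>2\<close>, \<open>R = (S P S)\<^sup>1\<^sup>/\<^sup>2\<close> and \<open>Q = R\<^sup>1\<^sup>/\<^sup>2\<close>, the dual choice
  \<open>K = S Q\<^sup>-\<^sup>1\<close>, \<open>L = S\<^sup>-\<^sup>1 Q\<close> has \<open>K\<^sup>T P K = R = L\<^sup>T Pd L\<close> and \<open>L K\<^sup>T = 1\<close>, so the trace bound
  reads \<open>2 tr U \<le> 2 tr R\<close>.  The primal choice \<open>U = S\<^sup>-\<^sup>1 R S\<close> attains it: its block form is the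
  square \<open>|R S\<^sup>-\<^sup>1 x + S y|\<^sup>2\<close>, that is, the Schur complement vanishes.\<close>
lemma fidelity_is_max_trace:
  fixes P Pd :: "real^'n^'n"
  assumes P: "pos_def P" and Pd: "pos_def Pd"
  defines "S \<equiv> psd_sqrt Pd"
  defines "R \<equiv> psd_sqrt (S ** P ** S)"
  shows "\<And>U. pos_semidef (block_matrix P U (transpose U) Pd) \<Longrightarrow> trace U \<le> trace R"
    and "\<exists>U. pos_semidef (block_matrix P U (transpose U) Pd) \<and> trace U = trace R"
proof -
  have S: "pos_def S" "S ** S = Pd" using psd_sqrt_pos_def[OF Pd] by (auto simp: S_def)
  have R: "pos_def R" "R ** R = S ** P ** S"
    using psd_sqrt_pos_def[OF pos_def_congruence[OF P S(1)]] by (auto simp: R_def)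
  define Q where "Q = psd_sqrt R"
  have Q: "pos_def Q" "Q ** Q = R" using psd_sqrt_pos_def[OF R(1)] by (auto simp: Q_def)
  obtain Si where Si: "S ** Si = mat 1" "Si ** S = mat 1" "transpose Si = Si"
    using pos_def_inverse[OF S(1)] .
  obtain Qi where Qi: "Q ** Qi = mat 1" "Qi ** Q = mat 1" "transpose Qi = Qi"
    using pos_def_inverse[OF Q(1)] .
  have sym: "transpose S = S" "transpose R = R" "transpose Q = Q" "transpose P = P" "transpose Pd = Pd"
    using S R Q P Pd by (simp_all add: pos_def_def)
  have cancel: "X ** S ** Si = X" "X ** Si ** S = X" "X ** Q ** Qi = X" "X ** Qi ** Q = X"
    for X :: "real^'n^'n"
    using Si Qi by (metis matrix_mul_assoc matrix_mul_rid)+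
  have PR: "P = Si ** R ** R ** Si"
  proof -
    have "Si ** R ** R ** Si = Si ** (R ** R) ** Si" by (simp add: matrix_mul_assoc)
    also have "\<dots> = P" by (simp add: R(2) matrix_mul_assoc cancel Si)
    finally show ?thesis ..
  qed
  show "trace U \<le> trace R" if U: "pos_semidef (block_matrix P U (transpose U) Pd)" for U
  proof -
    define K where "K = S ** Qi"
    define L where "L = Si ** Q"
    have "transpose K ** P ** K = Qi ** (S ** P ** S) ** Qi"
      by (simp add: K_def matrix_transpose_mul sym Qi(3) matrix_mul_assoc)
    also have "\<dots> = R"
      by (simp add: matrix_mul_assoc cancel Qi flip: R(2) Q(2))
    finally have 1: "transpose K ** P ** K = R" .
    have "transpose L ** Pd ** L = Q ** (Si ** (S ** S) ** Si) ** Q"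
      by (simp add: L_def S(2) matrix_transpose_mul sym Si(3) matrix_mul_assoc)
    also have "\<dots> = R"
      by (simp add: matrix_mul_assoc cancel Si Q(2))
    finally have 2: "transpose L ** Pd ** L = R" .
    have "trace (transpose K ** U ** L) = trace (U ** L ** transpose K)"
      using trace_mul_sym[of "transpose K" "U ** L"] by (simp add: matrix_mul_assoc)
    also have "U ** L ** transpose K = U"
      by (simp add: K_def L_def matrix_transpose_mul sym Qi(3) matrix_mul_assoc cancel)
    finally show ?thesis
      using block_psd_trace_bound[OF U, of K L] by (simp add: 1 2)
  qed
  show "\<exists>U. pos_semidef (block_matrix P U (transpose U) Pd) \<and> trace U = trace R"
  proof (intro exI conjI)
    define U where "U = Si ** R ** S"
    have "trace U = trace (R ** S ** Si)"
      using trace_mul_sym[of Si "R ** S"] by (simp add: U_def matrix_mul_assoc)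
    then show "trace (Si ** R ** S) = trace R" by (simp add: cancel U_def)
    have "0 \<le> x \<bullet> (P *v x) + 2 * (x \<bullet> (U *v y)) + y \<bullet> (Pd *v y)" for x y
    proof -
      have "((R ** Si) *v x) \<bullet> ((R ** Si) *v x) = x \<bullet> (P *v x)"
        unfolding inner_matrix_vector_left matrix_transpose_mul sym Si(3) PR
        by (simp only: matrix_vector_mul_assoc matrix_mul_assoc)
      moreover have "((R ** Si) *v x) \<bullet> (S *v y) = x \<bullet> (U *v y)"
        unfolding inner_matrix_vector_left matrix_transpose_mul sym Si(3) U_def
        by (simp only: matrix_vector_mul_assoc matrix_mul_assoc)
      moreover have "(S *v y) \<bullet> (S *v y) = y \<bullet> (Pd *v y)"
        unfolding inner_matrix_vector_left sym S(2)[symmetric]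
        by (simp only: matrix_vector_mul_assoc)
      ultimately have "x \<bullet> (P *v x) + 2 * (x \<bullet> (U *v y)) + y \<bullet> (Pd *v y)
          = ((R ** Si) *v x + S *v y) \<bullet> ((R ** Si) *v x + S *v y)"
        by (simp add: inner_add_left inner_add_right inner_commute)
      then show ?thesis by simp
    qed
    then show "pos_semidef (block_matrix P (Si ** R ** S) (transpose (Si ** R ** S)) Pd)"
      unfolding pos_semidef_block_matrix_iff by (simp add: sym U_def)
  qed
qed

section \<open>Equivalence of the two problems\<close>

text \<open>The distance is a square root, which squaring undoes only if the radicand is nonnegative;
  evaluated at an optimal \<open>U\<close>, this bound supplies that.\<close>
lemma objective_II_nonneg:
  fixes P Pd :: "real^'n^'n"
  assumes "pos_semidef (block_matrix P U (transpose U) Pd)"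
  shows "0 \<le> trace (P + Pd - 2 *\<^sub>R U)"
  using block_psd_trace_bound[OF assms, of "mat 1" "mat 1"]
  by (simp add: trace_add trace_sub trace_scaleR)

lemma objective_I_is_min:
  fixes P Pd :: "real^'n^'n"
  assumes P: "pos_def P" and Pd: "pos_def Pd"
  shows "\<And>U. pos_semidef (block_matrix P U (transpose U) Pd) \<Longrightarrow>
           objective_I Pd P \<le> trace (P + Pd - 2 *\<^sub>R U)"
    and "\<exists>U. pos_semidef (block_matrix P U (transpose U) Pd) \<and>
           objective_I Pd P = trace (P + Pd - 2 *\<^sub>R U)"
proof -
  define R where "R = psd_sqrt (psd_sqrt Pd ** P ** psd_sqrt Pd)"
  note max = fidelity_is_max_trace[OF P Pd, folded R_def]
  obtain U where U: "pos_semidef (block_matrix P U (transpose U) Pd)" "trace U = trace R"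
    using max(2) by blast
  have eq: "trace (P + Pd - 2 *\<^sub>R U) = trace (P + Pd - 2 *\<^sub>R R)"
    using U(2) by (simp add: trace_add trace_sub trace_scaleR)
  have obj: "objective_I Pd P = trace (P + Pd - 2 *\<^sub>R R)"
    using objective_II_nonneg[OF U(1)] eq by (simp add: objective_I_def bw_dist_def flip: R_def)
  show "objective_I Pd P \<le> trace (P + Pd - 2 *\<^sub>R V)"
    if "pos_semidef (block_matrix P V (transpose V) Pd)" for V
    using max(1)[OF that] unfolding obj by (simp add: trace_add trace_sub trace_scaleR)
  show "\<exists>U. pos_semidef (block_matrix P U (transpose U) Pd) \<and>
           objective_I Pd P = trace (P + Pd - 2 *\<^sub>R U)"
    using U eq obj by auto
qed

lemma feasible_I_iff:
  fixes A :: "real^'n^'n" and B :: "real^'m^'n" and D :: "real^'r^'n"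
  shows "feasible_I A B D P \<longleftrightarrow> pos_def P \<and>
    (\<exists>E. A ** P + B ** E + P ** transpose A + transpose E ** transpose B + D ** transpose D = 0)"
proof (cases "pos_def P")
  case True
  define Q where "Q = A ** P + P ** transpose A + D ** transpose D"
  have "transpose P = P" using True by (simp add: pos_def_def)
  then have sym: "transpose Q = Q"
    by (simp add: Q_def transpose_add matrix_transpose_mul add.commute)
  have regroup: "A ** P + B ** E + P ** transpose A + transpose E ** transpose B + D ** transpose D
      = B ** E + transpose E ** transpose B + Q" for E
    by (simp add: Q_def algebra_simps)
  show ?thesis
    unfolding feasible_I_def Q_def[symmetric] regroup
    using True projected_equation_iff_solvable[OF sym, of B] by blast
qed (simp add: feasible_I_def)

text \<open>Minimizing out \<open>y\<close>: if \<open>g x\<close> is the attained minimum of \<open>h (x, y)\<close> over the feasible \<open>y\<close>,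
  then minimizers of \<open>h\<close> project onto minimizers of \<open>g\<close>, and minimizers of \<open>g\<close> lift.\<close>
lemma is_arg_min_partial_minimization:
  fixes g :: "'a \<Rightarrow> real" and h :: "'a \<times> 'b \<Rightarrow> real"
  assumes proj: "\<And>x y. F (x, y) \<Longrightarrow> G x"
    and lower: "\<And>x y. F (x, y) \<Longrightarrow> g x \<le> h (x, y)"
    and attained: "\<And>x. G x \<Longrightarrow> \<exists>y. F (x, y) \<and> g x = h (x, y)"
  shows "is_arg_min h F (x, y) \<Longrightarrow> is_arg_min g G x \<and> g x = h (x, y)"
    and "is_arg_min g G x \<Longrightarrow> \<exists>y. is_arg_min h F (x, y)"
proof -
  assume "is_arg_min h F (x, y)"
  then have F: "F (x, y)" and min: "\<And>x' y'. F (x', y') \<Longrightarrow> h (x, y) \<le> h (x', y')"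
    by (auto simp: is_arg_min_linorder)
  have "h (x, y) \<le> g x'" if "G x'" for x'
    using attained[OF that] min by metis
  with F proj[OF F] lower[OF F] show "is_arg_min g G x \<and> g x = h (x, y)"
    by (force simp: is_arg_min_linorder intro: antisym)
next
  assume x: "is_arg_min g G x"
  then obtain y where y: "F (x, y)" "g x = h (x, y)"
    using attained by (auto simp: is_arg_min_linorder)
  have "h (x, y) \<le> h (x', y')" if "F (x', y')" for x' y'
    using x proj[OF that] lower[OF that] y(2) by (force simp: is_arg_min_linorder)
  with y show "\<exists>y. is_arg_min h F (x, y)"
    by (auto simp: is_arg_min_linorder)
qed

theorem theorem3:
  fixes A :: "real^'n^'n" and B :: "real^'m^'n" and D :: "real^'r^'n" and Pd :: "real^'n^'n"
  assumes "controllable A B"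
    and "controllable A D"
    and "pos_def Pd"
  shows "(\<forall>P E U. is_arg_min (objective_II Pd) (feasible_II A B D Pd) (P, E, U) \<longrightarrow>
            is_arg_min (objective_I Pd) (feasible_I A B D) P \<and>
            objective_I Pd P = objective_II Pd (P, E, U)) \<and>
         (\<forall>P. is_arg_min (objective_I Pd) (feasible_I A B D) P \<longrightarrow>
            (\<exists>E U. is_arg_min (objective_II Pd) (feasible_II A B D Pd) (P, E, U)))"
proof -
  have proj: "feasible_I A B D P" if "feasible_II A B D Pd (P, EU)" for P EU
    using that by (auto simp: feasible_I_iff feasible_II_def split: prod.splits)
  have lower: "objective_I Pd P \<le> objective_II Pd (P, EU)"
    if "feasible_II A B D Pd (P, EU)" for P and EU :: "(real^'n^'m) \<times> (real^'n^'n)"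
    using that objective_I_is_min(1)[OF _ assms(3)]
    by (auto simp: feasible_II_def objective_II_def split: prod.splits)
  have attained: "\<exists>EU. feasible_II A B D Pd (P, EU) \<and> objective_I Pd P = objective_II Pd (P, EU)"
    if feas: "feasible_I A B D P" for P
  proof -
    obtain E where P: "pos_def P"
      and E: "A ** P + B ** E + P ** transpose A + transpose E ** transpose B + D ** transpose D = 0"
      using feas unfolding feasible_I_iff by blast
    obtain U where U: "pos_semidef (block_matrix P U (transpose U) Pd)"
      "objective_I Pd P = trace (P + Pd - 2 *\<^sub>R U)"
      using objective_I_is_min(2)[OF P assms(3)] by blast
    have "feasible_II A B D Pd (P, E, U)"
      unfolding feasible_II_def prod.case using P U(1) E by blast
    moreover have "objective_I Pd P = objective_II Pd (P, E, U)"
      using U(2) by (simp only: objective_II_def prod.case)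
    ultimately show ?thesis by blast
  qed
  have project_min: "is_arg_min (objective_I Pd) (feasible_I A B D) P \<and>
      objective_I Pd P = objective_II Pd (P, EU)"
    if "is_arg_min (objective_II Pd) (feasible_II A B D Pd) (P, EU)" for P EU
    by (rule is_arg_min_partial_minimization(1)[OF _ _ _ that]) (fact proj lower attained)+
  have lift_min: "\<exists>EU. is_arg_min (objective_II Pd) (feasible_II A B D Pd) (P, EU)"
    if "is_arg_min (objective_I Pd) (feasible_I A B D) P" for P
    by (rule is_arg_min_partial_minimization(2)[OF _ _ _ that]) (fact proj lower attained)+
  show ?thesis
  proof (rule conjI; intro allI impI)
    fix P E U
    assume "is_arg_min (objective_II Pd) (feasible_II A B D Pd) (P, E, U)"
    then show "is_arg_min (objective_I Pd) (feasible_I A B D) P \<and>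
        objective_I Pd P = objective_II Pd (P, E, U)"
      by (rule project_min)
  next
    fix P
    assume "is_arg_min (objective_I Pd) (feasible_I A B D) P"
    then obtain EU where "is_arg_min (objective_II Pd) (feasible_II A B D Pd) (P, EU)"
      using lift_min by blast
    then show "\<exists>E U. is_arg_min (objective_II Pd) (feasible_II A B D Pd) (P, E, U)"
      by (cases EU) blast
  qed
qed

end
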